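(* The Hamming code $H_2=\{000,111\}$ is an optimal design on the cube graph $Q_3$.
   Context: $Q_3$ is the graph with vertex set $\{0,1\}^3$ in which two vertices are adjacent iff they differ in exactly one coordinate. For a connected graph $G=(V,E)$ with adjacency matrix $A$ and diagonal degree matrix $D$, $L=AD^{-1}-I$. A nonempty $W\subset V$ integrates $\phi:V\to\mathbb{R}$ if $\frac{1}{|W|}\sum_{w\in W}\phi(w)=\frac{1}{|V|}\sum_{v\in V}\phi(v)$, and integrates an eigenspace of $L$ if it integrates every eigenvector in a basis of it. A frequency ordering of a regular graph lists its distinct eigenspaces of $L$ in order of nonincreasing $|\lambda+1|$ ($\lambda$ the eigenvalue), with the eigenspace of eigenvalue $0$ first; eigenspaces with equal $|\lambda+1|$ are otherwise interchangeable. The efficacy of $W$ is the minimum, over all frequency orderings and all $k$ such that $W$ integrates the first $k$ eigenspaces, of $|W|$ divided by the sum of the dimensions of these first $k$ eigenspaces. $W$ is an optimal design if its efficacy is minimal among all nonempty subsets of $V$. *)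

theory Defs
  imports "HOL-Analysis.Analysis"
begin

(* A graph is given by its adjacency relation on a finite vertex type; functions on the
   vertices are the vectors real ^ 'v. *)

definition adjacency_matrix :: "('v::finite \<Rightarrow> 'v \<Rightarrow> bool) \<Rightarrow> real ^ 'v ^ 'v" where
  "adjacency_matrix adj = (\<chi> i j. if adj i j then 1 else 0)"

definition degree_matrix :: "('v::finite \<Rightarrow> 'v \<Rightarrow> bool) \<Rightarrow> real ^ 'v ^ 'v" where
  "degree_matrix adj = (\<chi> i j. if i = j then real (card {w. adj i w}) else 0)"

definition graph_laplacian :: "('v::finite \<Rightarrow> 'v \<Rightarrow> bool) \<Rightarrow> real ^ 'v ^ 'v" where
  "graph_laplacian adj = adjacency_matrix adj ** matrix_inv (degree_matrix adj) - mat 1"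

definition eigenspace :: "real ^ 'v ^ 'v \<Rightarrow> real \<Rightarrow> (real ^ 'v::finite) set" where
  "eigenspace M \<theta> = {\<phi>. M *v \<phi> = \<theta> *\<^sub>R \<phi>}"

definition eigenvalues :: "real ^ 'v ^ 'v \<Rightarrow> real set" where
  "eigenvalues M = {\<theta>. \<exists>\<phi> :: real ^ 'v::finite. \<phi> \<noteq> 0 \<and> M *v \<phi> = \<theta> *\<^sub>R \<phi>}"

definition integrates :: "'v::finite set \<Rightarrow> real ^ 'v \<Rightarrow> bool" where
  "integrates W \<phi> \<longleftrightarrow>
     (\<Sum>w\<in>W. \<phi> $ w) / real (card W) = (\<Sum>v\<in>UNIV. \<phi> $ v) / real CARD('v)"

definition integrates_space :: "'v::finite set \<Rightarrow> (real ^ 'v) set \<Rightarrow> bool" where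
  "integrates_space W E \<longleftrightarrow> (\<exists>B. independent B \<and> span B = E \<and> (\<forall>\<phi>\<in>B. integrates W \<phi>))"

(* Distinct eigenvalues have distinct eigenspaces, so an ordering of the eigenspaces is
   recorded as the list of the corresponding eigenvalues.  Intended for connected regular
   graphs, where 0 is an eigenvalue and \<bar>\<theta> + 1\<bar> \<le> 1 for all eigenvalues. *)
definition frequency_ordering :: "('v::finite \<Rightarrow> 'v \<Rightarrow> bool) \<Rightarrow> real list \<Rightarrow> bool" where
  "frequency_ordering adj \<theta>s \<longleftrightarrow>
     distinct \<theta>s \<and> set \<theta>s = eigenvalues (graph_laplacian adj) \<and>
     \<theta>s \<noteq> [] \<and> hd \<theta>s = 0 \<and> sorted_wrt (\<lambda>\<theta> \<mu>. \<bar>\<theta> + 1\<bar> \<ge> \<bar>\<mu> + 1\<bar>) \<theta>s"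

(* k \<ge> 1, as k = 0 would put 0 into the denominator.  The first eigenspace, that of 0, consists of
   the constants for a connected regular graph and is integrated by every nonempty W. *)
definition efficacy :: "('v::finite \<Rightarrow> 'v \<Rightarrow> bool) \<Rightarrow> 'v set \<Rightarrow> real" where
  "efficacy adj W =
     Min {real (card W) / real (\<Sum>\<theta>\<leftarrow>take k \<theta>s. dim (eigenspace (graph_laplacian adj) \<theta>)) | \<theta>s k.
          frequency_ordering adj \<theta>s \<and> 1 \<le> k \<and> k \<le> length \<theta>s \<and>
          (\<forall>\<theta>\<in>set (take k \<theta>s). integrates_space W (eigenspace (graph_laplacian adj) \<theta>))}"

definition optimal_design :: "('v::finite \<Rightarrow> 'v \<Rightarrow> bool) \<Rightarrow> 'v set \<Rightarrow> bool" where
  "optimal_design adj W \<longleftrightarrow> W \<noteq> {} \<and> (\<forall>W'. W' \<noteq> {} \<longrightarrow> efficacy adj W \<le> efficacy adj W')"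

(* The numeral type 2 is the integers modulo 2, with elements 0 and 1. *)
definition cube_adj :: "2 ^ 'n::finite \<Rightarrow> 2 ^ 'n \<Rightarrow> bool" where
  "cube_adj x y \<longleftrightarrow> card {i. x $ i \<noteq> y $ i} = 1"

definition H2 :: "(2 ^ 3) set" where
  "H2 = {vector [0, 0, 0], vector [1, 1, 1]}"

end

theory Submission
  imports Defs
begin

text \<open>The characters (Walsh functions) \<open>walsh S\<close> of the group \<open>\<int>\<^sub>2\<^sup>n\<close> form an eigenbasis of the Laplacian of
  the \<open>n\<close>-cube, and the eigenvalue \<open>- 2 |S| / n\<close> of \<open>walsh S\<close> depends only on the level \<open>|S|\<close>.
  So the eigenspaces are spanned by the levels, and for \<open>n = 3\<close> the eigenvalues
  \<open>0, -2/3, -4/3, -2\<close> of levels \<open>0, 1, 2, 3\<close> have multiplicities \<open>1, 3, 3, 1\<close>.  The values of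
  \<open>\<bar>\<theta> + 1\<bar>\<close> are \<open>1, 1/3, 1/3, 1\<close>, hence every frequency ordering starts with \<open>0, -2\<close>, and
  then the two three-dimensional eigenspaces follow in either order.  The sums of the dimensions
  of the first \<open>k\<close> eigenspaces are thus \<open>1, 2, 5, 8\<close> for both orderings.

  On \<open>H2\<close> a character of level \<open>l\<close> takes the values \<open>1\<close> and \<open>(-1)\<^sup>l\<close>, so \<open>H2\<close> integrates the odd
  levels as well as the constants.  If level 1 comes before level 2, these are the first three
  eigenspaces, which gives efficacy at most \<open>2/5\<close>.

  No set does better (\<open>design_lower_bound\<close>).  For \<open>k = 1\<close> the quotient is at least 1.  For
  \<open>k \<ge> 2\<close> the set integrates the parity character, whose values are \<open>1\<close> and \<open>-1\<close> and must cancel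
  on it, so it is not a singleton and for \<open>k \<le> 3\<close> the quotient is at least \<open>2/5\<close>.  For \<open>k = 4\<close> the
  set integrates every function, in particular the indicator of one of its points, which forces
  it to be the whole vertex set, with quotient 1.\<close>

section \<open>Matrices with an eigenbasis\<close>

text \<open>The family \<open>f\<close> is indexed, so that eigenvalues can be attached to the indices.  Expanding an
  eigenvector of eigenvalue \<open>\<theta>\<close> in the basis and comparing coefficients, every coefficient at an
  \<open>i\<close> with \<open>\<mu> i \<noteq> \<theta>\<close> vanishes.\<close>

lemma eigenspace_eq_span_eigenbasis:
  fixes f :: "'i::finite \<Rightarrow> real ^ 'v::finite"
  assumes inj: "inj f" and ind: "independent (range f)" and span: "span (range f) = UNIV"
    and eig: "\<And>i. M *v f i = \<mu> i *\<^sub>R f i"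
  shows "eigenspace M \<theta> = span (f ` {i. \<mu> i = \<theta>})"
proof
  show "span (f ` {i. \<mu> i = \<theta>}) \<subseteq> eigenspace M \<theta>"
  proof (rule span_minimal)
    show "subspace (eigenspace M \<theta>)"
      by (auto simp: subspace_def eigenspace_def matrix_vector_right_distrib
          matrix_vector_mult_scaleR scaleR_right_distrib)
  qed (auto simp: eigenspace_def eig)
next
  show "eigenspace M \<theta> \<subseteq> span (f ` {i. \<mu> i = \<theta>})"
  proof
    fix \<phi> assume "\<phi> \<in> eigenspace M \<theta>"
    then have M\<phi>: "M *v \<phi> = \<theta> *\<^sub>R \<phi>" by (simp add: eigenspace_def)
    have "\<phi> \<in> span (range f)" by (simp add: span)
    then obtain u where "\<phi> = (\<Sum>b\<in>range f. u b *\<^sub>R b)"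
      by (auto simp: span_finite)
    then have \<phi>: "\<phi> = (\<Sum>i\<in>UNIV. u (f i) *\<^sub>R f i)"
      by (simp add: sum.reindex[OF inj])
    have "M *v \<phi> = (\<Sum>i\<in>UNIV. (u (f i) * \<mu> i) *\<^sub>R f i)"
      unfolding \<phi> by (simp add: linear_sum[OF matrix_vector_mul_linear] matrix_vector_mult_scaleR eig)
    then have "(\<Sum>i\<in>UNIV. (u (f i) * \<mu> i) *\<^sub>R f i) = (\<Sum>i\<in>UNIV. (\<theta> * u (f i)) *\<^sub>R f i)"
      using M\<phi> unfolding \<phi> by (simp add: scaleR_sum_right)
    then have "(\<Sum>i\<in>UNIV. (u (f i) * (\<mu> i - \<theta>)) *\<^sub>R f i) = 0"
      by (simp add: right_diff_distrib scaleR_left_diff_distrib sum_subtractf mult.commute)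
    \<comment> \<open>Back to a sum over the set of basis vectors, the form in which independence is stated.\<close>
    then have "(\<Sum>b\<in>range f. (u b * (\<mu> (inv f b) - \<theta>)) *\<^sub>R b) = 0"
      by (simp add: sum.reindex[OF inj] inj)
    then have "u b * (\<mu> (inv f b) - \<theta>) = 0" if "b \<in> range f" for b
      using independentD[OF ind _ subset_refl, where u = "\<lambda>b. u b * (\<mu> (inv f b) - \<theta>)"] that by simp
    then have *: "u (f i) = 0" if "\<mu> i \<noteq> \<theta>" for i
      using that inj by fastforce
    have "u (f i) *\<^sub>R f i \<in> span (f ` {i. \<mu> i = \<theta>})" for i
      by (cases "\<mu> i = \<theta>") (auto simp: * span_zero intro: span_scale span_base)
    then show "\<phi> \<in> span (f ` {i. \<mu> i = \<theta>})"
      unfolding \<phi> by (intro span_sum)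
  qed
qed

lemma dim_eigenspace_eigenbasis:
  fixes f :: "'i::finite \<Rightarrow> real ^ 'v::finite"
  assumes "inj f" "independent (range f)" "span (range f) = UNIV"
    and "\<And>i. M *v f i = \<mu> i *\<^sub>R f i"
  shows "dim (eigenspace M \<theta>) = card {i. \<mu> i = \<theta>}"
proof -
  have "independent (f ` {i. \<mu> i = \<theta>})"
    using assms(2) by (rule independent_mono) auto
  then show ?thesis
    unfolding eigenspace_eq_span_eigenbasis[OF assms, of \<theta>]
    by (simp add: dim_eq_card_independent card_image inj_on_subset[OF assms(1)])
qed

lemma eigenvalues_eigenbasis:
  fixes f :: "'i::finite \<Rightarrow> real ^ 'v::finite"
  assumes "inj f" "independent (range f)" "span (range f) = UNIV"
    and "\<And>i. M *v f i = \<mu> i *\<^sub>R f i"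
  shows "eigenvalues M = range \<mu>"
proof (intro equalityI subsetI)
  fix \<theta> assume "\<theta> \<in> eigenvalues M"
  then obtain \<phi> where "\<phi> \<noteq> 0" "\<phi> \<in> eigenspace M \<theta>"
    by (auto simp: eigenvalues_def eigenspace_def)
  then have "{i. \<mu> i = \<theta>} \<noteq> {}"
    unfolding eigenspace_eq_span_eigenbasis[OF assms, of \<theta>]
    by (metis image_empty singletonD span_empty)
  then show "\<theta> \<in> range \<mu>" by auto
next
  fix \<theta> assume "\<theta> \<in> range \<mu>"
  then obtain i where "\<theta> = \<mu> i" by auto
  moreover have "f i \<noteq> 0" using assms(2) by (metis dependent_zero rangeI)
  ultimately show "\<theta> \<in> eigenvalues M"
    unfolding eigenvalues_def using assms(4) by blast
qed

section \<open>Linearity of integration\<close>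

lemma subspace_integrates: "subspace {\<phi>. integrates W \<phi>}"
  by (auto simp: subspace_def integrates_def sum.distrib add_divide_distrib
      simp flip: sum_distrib_left times_divide_eq_right)

text \<open>Being integrated by \<open>W\<close> is a linear condition, so it does not depend on the basis in which it
  is tested.\<close>

lemma integrates_space_span:
  assumes "independent B"
  shows "integrates_space W (span B) \<longleftrightarrow> (\<forall>\<phi>\<in>B. integrates W \<phi>)"
proof
  assume "integrates_space W (span B)"
  then obtain C where C: "span C = span B" "\<forall>\<phi>\<in>C. integrates W \<phi>"
    by (auto simp: integrates_space_def)
  have "span C \<subseteq> {\<phi>. integrates W \<phi>}"
    by (rule span_minimal) (use C in \<open>auto simp: subspace_integrates\<close>)
  then show "\<forall>\<phi>\<in>B. integrates W \<phi>" using C(1) span_superset[of B] by auto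
qed (use assms in \<open>auto simp: integrates_space_def\<close>)

text \<open>Integrating the indicator of a point of \<open>W\<close> compares \<open>1 / |W|\<close> with \<open>1 / |V|\<close>.\<close>

lemma integrates_everything_imp_UNIV:
  fixes W :: "'v::finite set"
  assumes "W \<noteq> {}" and "\<And>\<phi>. integrates W \<phi>"
  shows "W = UNIV"
proof -
  obtain a where "a \<in> W" using assms(1) by auto
  have "1 / real (card W) = 1 / real CARD('v)"
    using assms(2)[of "axis a 1"] \<open>a \<in> W\<close> by (simp add: integrates_def axis_def if_distrib)
  then show ?thesis
    using assms(1) by (simp add: card_eq_UNIV_imp_eq_UNIV)
qed

section \<open>The characters of the cube\<close>

text \<open>The sign convention identifies the elements \<open>0\<close> and \<open>1\<close> of \<open>\<int>\<^sub>2\<close> with \<open>1\<close> and \<open>-1\<close>, so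
  \<open>walsh S\<close> is the parity of the coordinates in \<open>S\<close>.\<close>

definition walsh :: "'n::finite set \<Rightarrow> real ^ (2 ^ 'n)" where
  "walsh S = (\<chi> x. \<Prod>i\<in>S. if x $ i = 0 then 1 else -1)"

definition flip :: "'n::finite \<Rightarrow> 2 ^ 'n \<Rightarrow> 2 ^ 'n" where
  "flip i x = (\<chi> j. if j = i then x $ j + 1 else x $ j)"

lemma neq_iff_eq_plus_one:
  fixes a b :: 2
  shows "a \<noteq> b \<longleftrightarrow> b = a + 1"
proof -
  have "(2 :: 2) = 0" "(1 :: 2) + 1 = 0" "(0 :: 2) \<noteq> 1" by simp_all
  then show ?thesis using exhaust_2[of a] exhaust_2[of b] add_0_left[of "1 :: 2"] by metis
qed

lemma flip_flip [simp]: "flip i (flip i x) = x"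
  by (auto simp: flip_def vec_eq_iff add.assoc)

lemma bij_flip: "bij (flip i)"
  by (rule o_bij[of "flip i"]) (auto simp: fun_eq_iff)

text \<open>This one identity makes the characters eigenvectors, since the neighbours of \<open>x\<close> are its
  flips, and also makes them orthogonal, since flipping is a bijection.\<close>

lemma walsh_flip: "walsh S $ flip i x = (if i \<in> S then -1 else 1) * walsh S $ x"
proof -
  have *: "(if x $ i + 1 = 0 then 1 else -1 :: real) = - (if x $ i = 0 then 1 else -1)"
    using neq_iff_eq_plus_one[of "x $ i" 0] by (cases "x $ i = 0") simp_all
  show ?thesis
  proof (cases "i \<in> S")
    case True
    have "(\<Prod>j\<in>S - {i}. if flip i x $ j = 0 then 1 else - 1 :: real)
      = (\<Prod>j\<in>S - {i}. if x $ j = 0 then 1 else - 1)"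
      by (intro prod.cong) (auto simp: flip_def)
    moreover have "flip i x $ i = x $ i + 1" by (simp add: flip_def)
    ultimately show ?thesis
      using True * unfolding walsh_def by (simp only: prod.remove[OF finite True] vec_lambda_beta) simp
  next
    case False
    then have "(\<Prod>j\<in>S. if flip i x $ j = 0 then 1 else - 1 :: real) 
      = (\<Prod>j\<in>S. if x $ j = 0 then 1 else - 1)"
      by (intro prod.cong) (auto simp: flip_def)
    with False show ?thesis by (simp add: walsh_def)
  qed
qed

lemma walsh_square: "walsh S $ x * walsh S $ x = 1"
  by (auto simp: walsh_def intro!: prod.neutral simp flip: prod.distrib)

lemma neighbours_cube: "{y. cube_adj x y} = range (\<lambda>i. flip i x)"
proof (intro equalityI subsetI)
  fix y assume "y \<in> {y. cube_adj x y}"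
  then obtain i where i: "{j. x $ j \<noteq> y $ j} = {i}"
    by (auto simp: cube_adj_def card_1_singleton_iff)
  have "y = flip i x"
    unfolding flip_def vec_eq_iff
    using i neq_iff_eq_plus_one by auto
  then show "y \<in> range (\<lambda>i. flip i x)" by auto
next
  fix y assume "y \<in> range (\<lambda>i. flip i x)"
  then obtain i where y: "y = flip i x" by auto
  have "{j. x $ j \<noteq> y $ j} = {i}" by (auto simp: y flip_def)
  then show "y \<in> {y. cube_adj x y}" by (simp add: cube_adj_def)
qed

lemma inj_flip: "inj (\<lambda>i. flip i x)"
proof
  fix i j assume "flip i x = flip j x"
  then have "flip i x $ i = flip j x $ i" by simp
  then show "i = j" by (auto simp: flip_def split: if_splits)
qed

lemma degree_cube: "card {y. cube_adj (x :: 2 ^ 'n::finite) y} = CARD('n)"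
  by (simp add: neighbours_cube card_image inj_flip)

text \<open>Of the \<open>n\<close> neighbours of a vertex, \<open>|S|\<close> reverse the sign of \<open>walsh S\<close> and the others keep it.\<close>

lemma adjacency_walsh:
  fixes S :: "'n::finite set"
  shows "adjacency_matrix cube_adj *v walsh S = (real CARD('n) - 2 * real (card S)) *\<^sub>R walsh S"
proof -
  have "(adjacency_matrix cube_adj *v walsh S) $ x
    = (real CARD('n) - 2 * real (card S)) * walsh S $ x" for x
  proof -
    have "(adjacency_matrix cube_adj *v walsh S) $ x = (\<Sum>y | cube_adj x y. walsh S $ y)"
      by (auto simp: adjacency_matrix_def matrix_vector_mult_def sum.inter_filter[symmetric]
          intro!: sum.mono_neutral_cong_right split: if_splits)
    also have "\<dots> = (\<Sum>i\<in>UNIV. walsh S $ flip i x)"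
      by (simp add: neighbours_cube sum.reindex[OF inj_flip])
    also have "\<dots> = (\<Sum>i\<in>UNIV. 1 - 2 * (if i \<in> S then 1 else 0)) * walsh S $ x"
      unfolding sum_distrib_right by (intro sum.cong) (auto simp: walsh_flip)
    also have "\<dots> = (real CARD('n) - 2 * real (card S)) * walsh S $ x"
      by (simp add: sum_subtractf sum.If_cases flip: sum_distrib_left)
    finally show ?thesis .
  qed
  then show ?thesis by (simp add: vec_eq_iff)
qed

lemma mat_vector_mult: "mat a *v \<phi> = a *\<^sub>R (\<phi> :: real ^ 'v::finite)"
proof -
  have "(\<Sum>j\<in>UNIV. (if i = j then a else 0) * \<phi> $ j) = (\<Sum>j\<in>UNIV. if i = j then a * \<phi> $ j else 0)" for i
    by (intro sum.cong) auto
  then show ?thesis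
    by (simp add: matrix_vector_mult_def mat_def vec_eq_iff)
qed

lemma matrix_inv_eqI:
  fixes A :: "real ^ 'n ^ 'm::finite"
  assumes "A ** B = mat 1" "B ** A = mat 1"
  shows "matrix_inv A = B"
  unfolding matrix_inv_def
proof (rule some_equality)
  fix C assume "A ** C = mat 1 \<and> C ** A = mat 1"
  then show "C = B"
    using assms(1) by (metis matrix_mul_assoc matrix_mul_lid matrix_mul_rid)
qed (use assms in simp)

lemma graph_laplacian_regular:
  fixes adj :: "'v::finite \<Rightarrow> 'v \<Rightarrow> bool"
  assumes "\<And>x. card {y. adj x y} = d" and "d > 0"
  shows "graph_laplacian adj *v \<phi> = (1 / real d) *\<^sub>R (adjacency_matrix adj *v \<phi>) - \<phi>"
proof -
  have "degree_matrix adj = mat (real d)"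
    by (simp add: degree_matrix_def mat_def assms vec_eq_iff)
  moreover have "matrix_inv (mat (real d)) = (mat (1 / real d) :: real^'v^'v)"
  proof (rule matrix_inv_eqI)
    show "mat (real d) ** mat (1 / real d) = (mat 1 :: real^'v^'v)"
      "mat (1 / real d) ** mat (real d) = (mat 1 :: real^'v^'v)"
      using assms(2) by (simp_all add: matrix_eq mat_vector_mult flip: matrix_vector_mul_assoc)
  qed
  ultimately have "matrix_inv (degree_matrix adj) = mat (1 / real d)" by simp
  then show ?thesis
    by (simp add: graph_laplacian_def matrix_vector_mult_diff_rdistrib matrix_vector_mult_scaleR
        mat_vector_mult flip: matrix_vector_mul_assoc)
qed

lemma laplacian_walsh:
  fixes S :: "'n::finite set"
  shows "graph_laplacian cube_adj *v walsh S = (- 2 * real (card S) / real CARD('n)) *\<^sub>R walsh S"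
proof -
  have "graph_laplacian cube_adj *v walsh S
    = ((1 / real CARD('n)) * (real CARD('n) - 2 * real (card S)) - 1) *\<^sub>R walsh S"
    by (simp add: graph_laplacian_regular[OF degree_cube] adjacency_walsh
        scaleR_diff_left scaleR_diff_right diff_divide_distrib)
  also have "(1 / real CARD('n)) * (real CARD('n) - 2 * real (card S)) - 1
    = - 2 * real (card S) / real CARD('n)"
    by (simp add: field_simps)
  finally show ?thesis .
qed

text \<open>Flipping a coordinate that lies in exactly one of \<open>S\<close> and \<open>T\<close> negates the product of the two
  characters, so its sum over the cube equals its own negative.\<close>

lemma orthogonal_walsh:
  assumes "S \<noteq> T"
  shows "orthogonal (walsh S) (walsh T)"
proof -
  obtain i where i: "i \<in> S \<longleftrightarrow> i \<notin> T" using assms by auto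
  let ?f = "\<lambda>x. walsh S $ x * walsh T $ x"
  have "(\<Sum>x\<in>UNIV. ?f x) = (\<Sum>x\<in>UNIV. ?f (flip i x))"
    by (rule sum.reindex_bij_betw[OF bij_flip, symmetric])
  also have "\<dots> = - (\<Sum>x\<in>UNIV. ?f x)"
    using i by (auto simp: walsh_flip sum_negf)
  finally show ?thesis by (simp add: orthogonal_def inner_vec_def)
qed

lemma walsh_nonzero: "walsh S \<noteq> 0"
  using walsh_square[of S 0] by auto

lemma inj_walsh: "inj walsh"
  by (rule injI) (metis orthogonal_walsh orthogonal_self walsh_nonzero)

lemma independent_walsh: "independent (range walsh)"
proof (rule pairwise_orthogonal_independent)
  show "pairwise orthogonal (range walsh)"
    by (auto simp: pairwise_def intro: orthogonal_walsh)
  show "0 \<notin> range walsh"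
    using walsh_nonzero by (metis imageE)
qed

text \<open>There are as many subsets of the coordinates as vertices, so the independent characters span.\<close>

lemma span_walsh: "span (range walsh :: (real ^ (2 ^ 'n::finite)) set) = UNIV"
proof -
  have "card (range walsh :: (real ^ (2 ^ 'n)) set) = DIM(real ^ (2 ^ 'n))"
    by (simp add: card_image inj_walsh)
  then show ?thesis
    using card_ge_dim_independent[OF subset_UNIV independent_walsh[where 'a = 'n]]
    by (simp add: top.extremum_unique)
qed

lemmas walsh_eigenbasis = inj_walsh independent_walsh span_walsh laplacian_walsh

text \<open>A character other than the constant one is orthogonal to \<open>walsh {}\<close>, the constant \<open>1\<close>, and so
  has mean zero on the cube.\<close>

lemma integrates_walsh_iff:
  assumes "W \<noteq> {}" "S \<noteq> {}"
  shows "integrates W (walsh S) \<longleftrightarrow> (\<Sum>w\<in>W. walsh S $ w) = 0"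
proof -
  have "(\<Sum>x\<in>UNIV. walsh S $ x) = 0"
    using orthogonal_walsh[OF assms(2)] by (simp add: orthogonal_def inner_vec_def walsh_def)
  with assms(1) show ?thesis by (simp add: integrates_def)
qed

lemma integrates_walsh_empty: "W \<noteq> {} \<Longrightarrow> integrates W (walsh {})"
  by (simp add: integrates_def walsh_def)

section \<open>The three-dimensional cube\<close>

abbreviation E :: "real \<Rightarrow> (real ^ (2 ^ 3)) set" where
  "E \<equiv> eigenspace (graph_laplacian cube_adj)"

lemma integrates_level_iff:
  "integrates_space W (E (- 2 * real k / 3)) \<longleftrightarrow> (\<forall>S. card S = k \<longrightarrow> integrates W (walsh S))"
proof -
  have *: "E (- 2 * real k / 3) = span (walsh ` {S. card S = k})"
    by (simp add: eigenspace_eq_span_eigenbasis[OF walsh_eigenbasis])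
  show ?thesis
    unfolding * integrates_space_span[OF independent_mono[OF independent_walsh image_mono[OF subset_UNIV]]]
    by auto
qed

lemma dim_level: "dim (E (- 2 * real k / 3)) = 3 choose k"
  using n_subsets[of "UNIV :: 3 set" k]
  by (simp add: dim_eigenspace_eigenbasis[OF walsh_eigenbasis])

lemma eigenvalues_Q3:
  "eigenvalues (graph_laplacian (cube_adj :: 2 ^ 3 \<Rightarrow> _)) = {0, -2, -2/3, -4/3}"
proof -
  have "range (card :: 3 set \<Rightarrow> nat) = {..3}"
  proof (intro equalityI subsetI)
    fix k :: nat assume "k \<in> {..3}"
    then obtain S :: "3 set" where "card S = k"
      using obtain_subset_with_card_n[of k "UNIV :: 3 set"] by auto
    then show "k \<in> range (card :: 3 set \<Rightarrow> nat)" by auto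
  next
    fix k assume "k \<in> range (card :: 3 set \<Rightarrow> nat)"
    then show "k \<in> {..3}" using card_mono[of "UNIV :: 3 set"] by auto
  qed
  also have "{..3} = {0, 1, 2, 3::nat}" by auto
  finally have r: "range (card :: 3 set \<Rightarrow> nat) = {0, 1, 2, 3}" .
  have "range (\<lambda>S :: 3 set. - 2 * real (card S) / real CARD(3)) 
    = (\<lambda>k. - 2 * real k / 3) ` range (card :: 3 set \<Rightarrow> nat)"
    by (simp add: image_image)
  also have "\<dots> = {0, -2, -2/3, -4/3}" unfolding r by auto
  finally show ?thesis by (simp add: eigenvalues_eigenbasis[OF walsh_eigenbasis])
qed

text \<open>Both \<open>0\<close> and \<open>-2\<close> have \<open>\<bar>\<theta> + 1\<bar> = 1\<close>, while the remaining two eigenvalues tie at \<open>1/3\<close>.\<close>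

lemma frequency_ordering_Q3:
  "frequency_ordering (cube_adj :: 2 ^ 3 \<Rightarrow> _) \<theta>s \<longleftrightarrow>
     \<theta>s = [0, -2, -2/3, -4/3] \<or> \<theta>s = [0, -2, -4/3, -2/3]"
proof
  assume *: "frequency_ordering (cube_adj :: 2 ^ 3 \<Rightarrow> _) \<theta>s"
  then have s: "distinct \<theta>s" "set \<theta>s = {0, -2, -2/3, -4/3}" "hd \<theta>s = 0"
    "sorted_wrt (\<lambda>\<theta> \<mu>. \<bar>\<theta> + 1\<bar> \<ge> \<bar>\<mu> + 1\<bar>) \<theta>s"
    by (auto simp: frequency_ordering_def eigenvalues_Q3)
  have "length \<theta>s = 4" using distinct_card[OF s(1)] s(2) by simp
  then obtain a b c d where l: "\<theta>s = [a, b, c, d]"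
    by (auto simp: eval_nat_numeral length_Suc_conv)
  have a: "a = 0" using s(3) l by simp
  have m: "b \<in> {-2, -2/3, -4/3}" "c \<in> {-2, -2/3, -4/3}" "d \<in> {-2, -2/3, -4/3}"
    using s(1,2) unfolding l a by auto
  have n: "b \<noteq> c" "b \<noteq> d" "c \<noteq> d" using s(1) l by auto
  have o: "\<bar>c + 1\<bar> \<le> \<bar>b + 1\<bar>" "\<bar>d + 1\<bar> \<le> \<bar>b + 1\<bar>" using s(4) l by auto
  show "\<theta>s = [0, -2, -2/3, -4/3] \<or> \<theta>s = [0, -2, -4/3, -2/3]"
    unfolding l a using m n o by auto
qed (auto simp: frequency_ordering_def eigenvalues_Q3)

lemma dims_Q3: "dim (E 0) = 1" "dim (E (-2)) = 1" "dim (E (-(2/3))) = 3" "dim (E (-(4/3))) = 3"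
  using dim_level[of 0] dim_level[of 1] dim_level[of 2] dim_level[of 3]
  by (simp_all add: eval_nat_numeral)

text \<open>The bound counts points: one for \<open>k = 1\<close>, at least two once the parity eigenspace is
  integrated, and all eight once every eigenspace is.\<close>

lemma design_lower_bound:
  fixes W :: "(2 ^ 3) set"
  assumes W: "W \<noteq> {}" and fo: "frequency_ordering (cube_adj :: 2 ^ 3 \<Rightarrow> _) \<theta>s"
    and k: "1 \<le> k" "k \<le> length \<theta>s"
    and int: "\<forall>\<theta>\<in>set (take k \<theta>s). integrates_space W (E \<theta>)"
  shows "2 / 5 \<le> real (card W) / real (\<Sum>\<theta>\<leftarrow>take k \<theta>s. dim (E \<theta>))"
proof -
  have pos: "card W \<ge> 1" using W by (simp add: Suc_le_eq card_gt_0_iff)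
  \<comment> \<open>The eigenvalue \<open>-2\<close> is that of level 3, the parity character \<open>walsh UNIV\<close>.\<close>
  have ge2: "card W \<ge> 2" if "integrates_space W (E (-2))"
  proof (rule ccontr)
    assume "\<not> card W \<ge> 2"
    then have "card W = 1" using pos by simp
    then obtain w where w: "W = {w}" by (auto simp: card_1_singleton_iff)
    have "integrates W (walsh UNIV)"
      using that integrates_level_iff[of W 3] by simp
    then have "walsh UNIV $ w = 0" using w by (simp add: integrates_walsh_iff)
    then show False using walsh_square[of UNIV w] by simp
  qed
  have all: "card W = 8" if "\<forall>\<theta>\<in>set \<theta>s. integrates_space W (E \<theta>)"
  proof -
    have "integrates W (walsh S)" for S
    proof -
      have "- 2 * real (card S) / 3 \<in> eigenvalues (graph_laplacian (cube_adj :: 2 ^ 3 \<Rightarrow> _))"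
        unfolding eigenvalues_eigenbasis[OF walsh_eigenbasis] by auto
      then show ?thesis
        using that fo integrates_level_iff unfolding frequency_ordering_def by metis
    qed
    then have "span (range walsh) \<subseteq> {\<phi>. integrates W \<phi>}"
      by (intro span_minimal subspace_integrates) auto
    then have "W = UNIV"
      by (intro integrates_everything_imp_UNIV[OF W]) (auto simp: span_walsh)
    then show ?thesis by simp
  qed
  obtain a b where \<theta>s: "\<theta>s = [0, -2, a, b]" and ab: "dim (E a) = 3" "dim (E b) = 3"
    using fo unfolding frequency_ordering_Q3 by (auto simp: dims_Q3)
  have "k = 1 \<or> k = 2 \<or> k = 3 \<or> k = 4" using k by (auto simp: \<theta>s)
  then show ?thesis
  proof (elim disjE)
    assume "k = 1" then show ?thesis using pos by (simp add: \<theta>s dims_Q3)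
  next
    assume "k = 2" then show ?thesis using pos by (simp add: \<theta>s dims_Q3)
  next
    assume "k = 3" then show ?thesis using ge2 int by (simp add: \<theta>s dims_Q3 ab eval_nat_numeral)
  next
    assume "k = 4" then show ?thesis using all int by (simp add: \<theta>s dims_Q3 ab eval_nat_numeral)
  qed
qed

text \<open>The word \<open>111\<close> is the complement of \<open>000\<close>, so a character of odd level takes opposite values
  on them.\<close>

lemma H2_integrates_walsh:
  assumes "odd (card S)" shows "integrates H2 (walsh S)"
proof -
  have ne: "(vector [0, 0, 0] :: 2 ^ 3) \<noteq> vector [1, 1, 1]"
    by (simp add: vec_eq_iff forall_3 vector_3)
  have 0: "(vector [0, 0, 0] :: 2 ^ 3) $ i = 0" and 1: "(vector [1, 1, 1] :: 2 ^ 3) $ i = 1" for i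
    using exhaust_3[of i] by (auto simp: vector_3)
  have "(\<Sum>w\<in>H2. walsh S $ w) = 1 + (- 1) ^ card S"
    using ne by (simp add: H2_def walsh_def 0 1)
  with assms show ?thesis
    by (subst integrates_walsh_iff) (auto simp: H2_def)
qed

theorem theorem5p8:
  shows "optimal_design (cube_adj :: 2 ^ 3 \<Rightarrow> 2 ^ 3 \<Rightarrow> bool) H2"
proof -
  define R where "R W = {real (card W) / real (\<Sum>\<theta>\<leftarrow>take k \<theta>s. dim (E \<theta>)) | \<theta>s k.
          frequency_ordering (cube_adj :: 2 ^ 3 \<Rightarrow> _) \<theta>s \<and> 1 \<le> k \<and> k \<le> length \<theta>s \<and>
          (\<forall>\<theta>\<in>set (take k \<theta>s). integrates_space W (E \<theta>))}" for W
  have eff: "efficacy cube_adj W = Min (R W)" for W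
    by (simp add: efficacy_def R_def)
  let ?o = "[0, -2, -2/3, -4/3 :: real]"
  have fo: "frequency_ordering (cube_adj :: 2 ^ 3 \<Rightarrow> _) ?o"
    by (simp add: frequency_ordering_Q3)
  have fin: "finite (R W)" for W
  proof (rule finite_subset)
    show "R W \<subseteq> (\<lambda>(\<theta>s, k). real (card W) / real (\<Sum>\<theta>\<leftarrow>take k \<theta>s. dim (E \<theta>))) `
      ({[0, -2, -2/3, -4/3], [0, -2, -4/3, -2/3]} \<times> {..4})"
      unfolding R_def frequency_ordering_Q3 by force
  qed simp
  have card_H2: "card H2 = 2"
    by (simp add: H2_def vec_eq_iff forall_3 vector_3)
  have "H2 \<noteq> {}" by (simp add: H2_def)
  moreover have "efficacy cube_adj H2 \<le> 2 / 5"
  proof -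
    have "integrates_space H2 (E 0)" "integrates_space H2 (E (-2))" "integrates_space H2 (E (-(2/3)))"
      using integrates_level_iff[of H2 0] integrates_level_iff[of H2 3] integrates_level_iff[of H2 1]
        integrates_walsh_empty[OF \<open>H2 \<noteq> {}\<close>]
      by (simp_all add: H2_integrates_walsh)
    \<comment> \<open>The first three eigenspaces of the ordering with level 1 before level 2 have total
      dimension \<open>1 + 1 + 3\<close>.\<close>
    then have "real (card H2) / real (\<Sum>\<theta>\<leftarrow>take 3 ?o. dim (E \<theta>)) \<in> R H2"
      unfolding R_def using fo
      by (intro CollectI exI[of _ ?o] exI[of _ "3::nat"]) (simp add: eval_nat_numeral)
    moreover have "real (card H2) / real (\<Sum>\<theta>\<leftarrow>take 3 ?o. dim (E \<theta>)) = 2 / 5"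
      by (simp add: card_H2 dims_Q3 eval_nat_numeral)
    ultimately show ?thesis unfolding eff using Min_le[OF fin] by metis
  qed
  moreover have "2 / 5 \<le> efficacy cube_adj W" if "W \<noteq> {}" for W :: "(2 ^ 3) set"
  proof -
    \<comment> \<open>The quotient for the constants alone exists for every \<open>W\<close>; without it the minimum would be
      taken over a possibly empty set.\<close>
    have "integrates_space W (E 0)"
      using integrates_level_iff[of W 0] integrates_walsh_empty[OF that] by simp
    then have "real (card W) / real (\<Sum>\<theta>\<leftarrow>take 1 ?o. dim (E \<theta>)) \<in> R W"
      unfolding R_def using fo by (intro CollectI exI[of _ ?o] exI[of _ "1::nat"]) simp
    then have "R W \<noteq> {}" by blast
    moreover have "\<forall>r\<in>R W. 2 / 5 \<le> r"
      unfolding R_def using design_lower_bound[OF that] by blast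
    ultimately show ?thesis unfolding eff using fin by (subst Min_ge_iff) auto
  qed
  ultimately show ?thesis unfolding optimal_design_def using order_trans by blast
qed

end
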